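(* Let $d\in\mathbb{N}$, let $A\in M_d$, and let $\alpha$ be an extreme point of the numerical range $W(A)$. Then a flat boundary portion is born at $\alpha$ if and only if $\alpha$ is multiply generated.
   Context: $M_d$ is the set of complex $d\times d$ matrices. For $A\in M_d$ the numerical range map is $f_A:S\mathbb{C}^d\to\mathbb{C}$, $x\mapsto x^*Ax$, where $S\mathbb{C}^d=\{x\in\mathbb{C}^d\mid x^*x=1\}$, and the numerical range is $W(A)=f_A(S\mathbb{C}^d)$, a compact convex subset of $\mathbb{C}\cong\mathbb{R}^2$. A point $\alpha\in W(A)$ is multiply generated if $f_A^{-1}(\alpha)$ contains at least two linearly independent vectors. A flat boundary portion of $W(A)$ is a maximal proper (i.e. not a single point) segment in the boundary of $W(A)$; equivalently, a one-dimensional face of $W(A)$ (if $W(A)$ is itself a non-degenerate segment, then it is its own flat boundary portion). For $\alpha\in W(A)$, a flat boundary portion is said to be born at $\alpha$ if there exist a sequence $(A_i)_{i\in\mathbb{N}}\subset M_d$ converging to $A$ and, for each $i\in\mathbb{N}$, a flat boundary portion $s_i$ of $W(A_i)$, such that $(s_i)_{i\in\mathbb{N}}$ converges to $\{\alpha\}$ in the Hausdorff distance. *)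

theory Defs
  imports "HOL-Analysis.Analysis"
begin

definition hermitian_prod :: "complex ^ 'n \<Rightarrow> complex ^ 'n \<Rightarrow> complex"
  where "hermitian_prod x y = (\<Sum>i\<in>UNIV. cnj (x $ i) * y $ i)"

definition csphere :: "(complex ^ 'n) set"
  where "csphere = {x. hermitian_prod x x = 1}"

definition numerical_range_map :: "complex ^ 'n ^ 'n \<Rightarrow> complex ^ 'n \<Rightarrow> complex"
  where "numerical_range_map A x = hermitian_prod x (A *v x)"

definition numerical_range :: "complex ^ 'n ^ 'n \<Rightarrow> complex set"
  where "numerical_range A = numerical_range_map A ` csphere"

(* Independence must be over the complex numbers, hence vec.independent (scalar
   multiplication *s) and not the library's real independent: x and \<i> *s x are
   independent over the reals. *)
definition multiply_generated :: "complex ^ 'n ^ 'n \<Rightarrow> complex \<Rightarrow> bool"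
  where "multiply_generated A \<alpha> \<longleftrightarrow>
    (\<exists>x y. x \<in> csphere \<inter> numerical_range_map A -` {\<alpha>} \<and>
           y \<in> csphere \<inter> numerical_range_map A -` {\<alpha>} \<and>
           x \<noteq> y \<and> vec.independent {x, y})"

definition proper_segment :: "complex set \<Rightarrow> bool"
  where "proper_segment s \<longleftrightarrow> (\<exists>a b. a \<noteq> b \<and> s = closed_segment a b)"

(* The boundary is taken in the plane, so a numerical range that is itself a
   non-degenerate segment is its own frontier, hence its own flat boundary portion. *)
definition flat_boundary_portion :: "complex ^ 'n ^ 'n \<Rightarrow> complex set \<Rightarrow> bool"
  where "flat_boundary_portion A s \<longleftrightarrow>
    proper_segment s \<and> s \<subseteq> frontier (numerical_range A) \<and>
    (\<forall>t. proper_segment t \<and> t \<subseteq> frontier (numerical_range A) \<and> s \<subseteq> t \<longrightarrow> t = s)"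

(* Meaningful for nonempty bounded sets only; suprema of unbounded or empty sets
   of reals are unspecified. *)
definition hausdorff_dist :: "'a::metric_space set \<Rightarrow> 'a set \<Rightarrow> real"
  where "hausdorff_dist S T = max (SUP x\<in>S. infdist x T) (SUP y\<in>T. infdist y S)"

definition flat_boundary_portion_born_at :: "complex ^ 'n ^ 'n \<Rightarrow> complex \<Rightarrow> bool"
  where "flat_boundary_portion_born_at A \<alpha> \<longleftrightarrow>
    (\<exists>(B :: nat \<Rightarrow> complex ^ 'n ^ 'n) s.
       B \<longlonglongrightarrow> A \<and> (\<forall>i. flat_boundary_portion (B i) (s i)) \<and>
       (\<lambda>i. hausdorff_dist (s i) {\<alpha>}) \<longlonglongrightarrow> 0)"

end

theory Submission
  imports Defs
begin

text \<open>
  Write \<open>f(v) = v* A v\<close> for the numerical range map, as a quadratic form on all vectors. Both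
  directions rest on one fact, \<open>numerical_range_map_combination_in_face\<close>: for a face \<open>F\<close> of the
  convex set \<open>W(A)\<close>, the unit vectors with value in \<open>F\<close> are the unit vectors of a complex linear
  subspace. Indeed the parallelogram law exhibits a convex combination of the values at \<open>p\<close> and
  \<open>q\<close> as a convex combination of the normalised values at \<open>p + q\<close> and \<open>p - q\<close>, so if the former
  lies in \<open>F\<close>, so do the latter. Convexity of \<open>W(A)\<close> is the Toeplitz--Hausdorff theorem,
  \<open>convex_numerical_range\<close>. It yields supporting lines, and with them the identification of flat
  boundary portions with the non-degenerate intersections of \<open>W(A)\<close> with a supporting line,
  \<open>flat_boundary_portion_iff_exposed\<close>.

  Suppose a flat boundary portion is born at \<open>\<alpha>\<close>, through matrices \<open>B\<^sub>i\<close> and segments \<open>s\<^sub>i\<close>.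
  Two vectors generating the end points of \<open>s\<^sub>i\<close> span a plane. As \<open>s\<^sub>i\<close> is a face, all unit vectors
  of this plane have values in \<open>s\<^sub>i\<close>, in particular the members of an orthonormal basis. By
  compactness these pairs accumulate at an orthonormal pair for \<open>A\<close>, both members of which have the
  value \<open>\<alpha>\<close> because the \<open>s\<^sub>i\<close> shrink to \<open>\<alpha>\<close>. Orthonormality is what keeps the two vectors independent
  in the limit.

  Conversely let \<open>\<alpha>\<close> be extreme and multiply generated. As \<open>{\<alpha>}\<close> is a face, there is an orthonormal
  pair \<open>x, y\<close> such that \<open>f\<close> is constantly \<open>\<alpha>\<close> on the unit sphere of its span \<open>V\<close>. Choose a supporting
  line of \<open>W(A)\<close> at \<open>\<alpha>\<close> with outer normal \<open>u\<close>. Adding to \<open>A\<close> a small multiple of \<open>u (P - 1)\<close>, where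
  \<open>P\<close> is the orthogonal projection to \<open>V\<close>, pushes the values of all unit vectors outside \<open>V\<close> strictly
  to the inner side of the line, whether or not they were on it before. Adding the same small multiple
  \<open>r\<close> of \<open>\<i> u x x*\<close> stretches the single point \<open>\<alpha>\<close>, generated by \<open>V\<close>, to the segment from \<open>\<alpha>\<close> to
  \<open>\<alpha> + \<i> r u\<close> along the line. This segment is therefore the whole intersection with the line, hence
  a flat boundary portion, and it shrinks to \<open>\<alpha>\<close> with \<open>r\<close>.
\<close>

section \<open>The quadratic form of a matrix\<close>

lemma hermitian_prod_add_left: "hermitian_prod (x + y) z = hermitian_prod x z + hermitian_prod y z"
  by (simp add: hermitian_prod_def distrib_right sum.distrib)

lemma hermitian_prod_add_right: "hermitian_prod x (y + z) = hermitian_prod x y + hermitian_prod x z"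
  by (simp add: hermitian_prod_def distrib_left sum.distrib)

lemma hermitian_prod_diff_right: "hermitian_prod x (y - z) = hermitian_prod x y - hermitian_prod x z"
  by (simp add: hermitian_prod_def right_diff_distrib sum_subtractf)

lemma hermitian_prod_scale_left: "hermitian_prod (c *s x) y = cnj c * hermitian_prod x y"
  by (simp add: hermitian_prod_def sum_distrib_left mult_ac)

lemma hermitian_prod_scale_right: "hermitian_prod x (c *s y) = c * hermitian_prod x y"
  by (simp add: hermitian_prod_def sum_distrib_left mult_ac)

lemmas hermitian_prod_simps =
  hermitian_prod_add_left hermitian_prod_add_right hermitian_prod_diff_right
  hermitian_prod_scale_left hermitian_prod_scale_right

lemma cnj_hermitian_prod: "cnj (hermitian_prod x y) = hermitian_prod y x"
  by (simp add: hermitian_prod_def mult.commute)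

lemma hermitian_prod_self: "hermitian_prod x x = of_real ((norm x)\<^sup>2)"
proof -
  have "(norm x)\<^sup>2 = (\<Sum>i\<in>UNIV. (norm (x $ i))\<^sup>2)"
    by (simp add: norm_vec_def L2_set_def sum_nonneg)
  then show ?thesis
    by (simp add: hermitian_prod_def complex_norm_square mult.commute del: of_real_power)
qed

lemma csphere_eq_sphere: "(csphere :: (complex ^ 'n) set) = sphere 0 1"
proof -
  have "hermitian_prod x x = 1 \<longleftrightarrow> norm x = 1" for x :: "complex ^ 'n"
  proof -
    have "hermitian_prod x x = 1 \<longleftrightarrow> (norm x)\<^sup>2 = 1\<^sup>2"
      unfolding hermitian_prod_self by (metis of_real_1 of_real_eq_iff one_power2)
    also have "\<dots> \<longleftrightarrow> norm x = 1"
      by (metis norm_ge_zero power2_eq_imp_eq zero_le_one)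
    finally show ?thesis .
  qed
  then show ?thesis
    unfolding csphere_def sphere_def by (simp add: dist_norm)
qed

lemma norm_vector_scalar_mult: "norm (c *s x) = norm c * norm (x :: complex ^ 'n)"
proof -
  have "complex_of_real ((norm (c *s x))\<^sup>2) = of_real ((norm c * norm x)\<^sup>2)"
    unfolding hermitian_prod_self[symmetric] hermitian_prod_scale_left hermitian_prod_scale_right
    by (simp add: hermitian_prod_self power_mult_distrib complex_norm_square mult_ac del: of_real_power)
  then have "(norm (c *s x))\<^sup>2 = (norm c * norm x)\<^sup>2"
    by (simp only: of_real_eq_iff)
  then show ?thesis
    by (rule power2_eq_imp_eq) simp_all
qed

lemma numerical_range_map_scale:
  "numerical_range_map A (c *s x) = of_real ((norm c)\<^sup>2) * numerical_range_map A x"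
  by (simp add: numerical_range_map_def vector_scalar_commute hermitian_prod_simps
      complex_norm_square mult_ac del: of_real_power)

lemma numerical_range_map_combination:
  "numerical_range_map A (a *s x + b *s y) =
    of_real ((norm a)\<^sup>2) * numerical_range_map A x + of_real ((norm b)\<^sup>2) * numerical_range_map A y
    + cnj a * b * hermitian_prod x (A *v y) + cnj b * a * hermitian_prod y (A *v x)"
  by (simp add: numerical_range_map_def vector_scalar_commute
        hermitian_prod_simps complex_norm_square algebra_simps del: of_real_power)

lemma numerical_range_map_parallelogram:
  "numerical_range_map A (x + y) + numerical_range_map A (x - y) =
    2 * numerical_range_map A x + 2 * numerical_range_map A y"
  using numerical_range_map_combination[of A 1 x 1 y]
    numerical_range_map_combination[of A 1 x "-1" y]
  by (simp add: vector_smult_lneg)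

lemma numerical_range_map_add:
  "numerical_range_map (A + B) x = numerical_range_map A x + numerical_range_map B x"
  by (simp add: numerical_range_map_def matrix_vector_mult_add_rdistrib hermitian_prod_add_right)

lemma numerical_range_map_diff:
  "numerical_range_map (A - B) x = numerical_range_map A x - numerical_range_map B x"
  by (simp add: numerical_range_map_def matrix_vector_mult_diff_rdistrib hermitian_prod_diff_right)

lemma mat_mult_vector: "mat c *v x = c *s x"
  by (simp add: mat_def matrix_vector_mult_def vec_eq_iff if_distrib [of "\<lambda>x. x * y" for y] cong: if_cong)

lemma numerical_range_map_mat_mult:
  "numerical_range_map (mat c ** A) x = c * numerical_range_map A x"
  by (simp add: numerical_range_map_def matrix_vector_mul_assoc[symmetric] mat_mult_vector
      hermitian_prod_scale_right)

lemma numerical_range_map_mat: "numerical_range_map (mat c) x = c * of_real ((norm x)\<^sup>2)"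
  by (simp add: numerical_range_map_def mat_mult_vector hermitian_prod_scale_right hermitian_prod_self)

lemma tendsto_numerical_range_map:
  assumes "(B \<longlongrightarrow> A) F" "(v \<longlongrightarrow> x) F"
  shows "((\<lambda>i. numerical_range_map (B i) (v i)) \<longlongrightarrow> numerical_range_map A x) F"
  unfolding numerical_range_map_def hermitian_prod_def matrix_vector_mult_def vec_lambda_beta
  by (intro tendsto_intros assms)

lemma tendsto_hermitian_prod:
  assumes "(v \<longlongrightarrow> x) F" "(w \<longlongrightarrow> y) F"
  shows "((\<lambda>i. hermitian_prod (v i) (w i)) \<longlongrightarrow> hermitian_prod x y) F"
  unfolding hermitian_prod_def by (intro tendsto_intros assms)

lemma continuous_on_numerical_range_map: "continuous_on S (numerical_range_map A)"
  unfolding continuous_on_def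
  by (auto intro: tendsto_numerical_range_map)

lemma compact_numerical_range: "compact (numerical_range A)"
  unfolding numerical_range_def csphere_eq_sphere
  by (intro compact_continuous_image continuous_on_numerical_range_map compact_sphere)

text \<open>Passes between the quadratic form on all vectors and the points of the numerical range.\<close>

lemma numerical_range_map_eq_norm_mult:
  assumes "v \<noteq> 0"
  obtains z where "z \<in> numerical_range A"
    and "numerical_range_map A v = of_real ((norm v)\<^sup>2) * z"
proof -
  define w where "w = complex_of_real (1 / norm v) *s v"
  have "norm w = 1"
    using assms by (simp add: w_def norm_vector_scalar_mult norm_divide)
  then have "numerical_range_map A w \<in> numerical_range A"
    by (simp add: numerical_range_def csphere_eq_sphere)
  moreover have "v = complex_of_real (norm v) *s w"
    using assms by (simp add: w_def vector_smult_assoc)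
  then have "numerical_range_map A v = of_real ((norm v)\<^sup>2) * numerical_range_map A w"
    by (metis numerical_range_map_scale norm_of_real abs_norm_cancel)
  ultimately show ?thesis
    using that by blast
qed

section \<open>Convexity of the numerical range\<close>

text \<open>
  The heart of the Toeplitz--Hausdorff theorem. Multiplying \<open>x\<close> by a unit scalar \<open>c\<close> does not change its
  value, and for a suitable \<open>c\<close> the mixed terms of the form become real. Then the form is real along
  the path from \<open>c x\<close> to \<open>y\<close>, and the intermediate value theorem applies.
\<close>

lemma unit_interval_subset_numerical_range:
  assumes x: "norm x = 1" "numerical_range_map Q x = 0"
    and y: "norm y = 1" "numerical_range_map Q y = 1"
    and s: "0 \<le> s" "s \<le> 1"
  shows "of_real s \<in> numerical_range Q"
proof -
  define w where "w = hermitian_prod y (Q *v x) - cnj (hermitian_prod x (Q *v y))"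
  define c where "c = (if w = 0 then 1 else cnj w / norm w)"
  have c: "norm c = 1"
    by (simp add: c_def norm_divide)
  have "c * w = of_real (norm w)"
    by (simp add: c_def mult.commute[of "cnj w" w] complex_norm_square[symmetric] power2_eq_square del: of_real_power)
  then have cw: "Im (c * w) = 0"
    by simp
  define v where "v t = (of_real (1 - t) * c) *s x + of_real t *s y" for t :: real
  have "Im (cnj c * hermitian_prod x (Q *v y) + c * hermitian_prod y (Q *v x)) = Im (c * w)"
    by (simp add: w_def algebra_simps)
  then have cross: "Im (cnj c * hermitian_prod x (Q *v y) + c * hermitian_prod y (Q *v x)) = 0"
    using cw by simp
  have "numerical_range_map Q (v t) = of_real (t\<^sup>2) + of_real (t * (1 - t)) *
      (cnj c * hermitian_prod x (Q *v y) + c * hermitian_prod y (Q *v x))" for t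
    unfolding v_def numerical_range_map_combination using x y
    by (simp add: algebra_simps)
  then have real: "Im (numerical_range_map Q (v t)) = 0" for t
    using cross by (simp del: of_real_mult of_real_diff)
  \<comment> \<open>A zero on the path would make \<open>x\<close> and \<open>y\<close> proportional, which their values exclude.\<close>
  have nonzero: "v t \<noteq> 0" for t
  proof
    assume *: "v t = 0"
    have "(of_real (1 - t) * c) *s x = (- of_real t) *s y"
      using * by (simp add: v_def vector_smult_lneg eq_neg_iff_add_eq_0)
    then have "numerical_range_map Q ((of_real (1 - t) * c) *s x) = numerical_range_map Q ((- of_real t) *s y)"
      "norm ((of_real (1 - t) * c) *s x) = norm ((- of_real t) *s y)"
      by simp_all
    then show False
      unfolding numerical_range_map_scale norm_vector_scalar_mult using x y c
      by (auto simp: norm_mult)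
  qed
  define \<phi> where "\<phi> t = Re (numerical_range_map Q (v t)) / (norm (v t))\<^sup>2" for t
  have v_cont: "continuous_on {0..1} v"
    unfolding v_def vector_scalar_mult_def by (intro continuous_intros)
  have "\<exists>t. 0 \<le> t \<and> t \<le> 1 \<and> \<phi> t = s"
  proof (rule IVT')
    show "\<phi> 0 \<le> s" "s \<le> \<phi> 1"
      using x y s by (simp_all add: \<phi>_def v_def numerical_range_map_scale)
    have "continuous_on {0..1} (\<lambda>t. numerical_range_map Q (v t))"
      by (rule continuous_on_compose2[OF continuous_on_numerical_range_map[of UNIV] v_cont]) simp
    then show "continuous_on {0..1} \<phi>"
      unfolding \<phi>_def using nonzero v_cont by (intro continuous_intros) auto
  qed simp
  then obtain t where t: "\<phi> t = s" by blast
  obtain z where z: "z \<in> numerical_range Q"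
    "numerical_range_map Q (v t) = of_real ((norm (v t))\<^sup>2) * z"
    using numerical_range_map_eq_norm_mult[OF nonzero] .
  have "Re z = s" "Im z = 0"
    using t real[of t] nonzero[of t] unfolding \<phi>_def z(2) by simp_all
  then have "z = of_real s"
    by (simp add: complex_eq_iff)
  with z show ?thesis by simp
qed

theorem convex_numerical_range: "convex (numerical_range A)"
proof -
  have "closed_segment \<alpha> \<beta> \<subseteq> numerical_range A"
    if \<alpha>: "\<alpha> \<in> numerical_range A" and \<beta>: "\<beta> \<in> numerical_range A" for \<alpha> \<beta>
  proof (cases "\<alpha> = \<beta>")
    case True
    then show ?thesis using \<alpha> by simp
  next
    case False
    obtain x y where x: "norm x = 1" "numerical_range_map A x = \<alpha>"
      and y: "norm y = 1" "numerical_range_map A y = \<beta>"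
      using \<alpha> \<beta> by (auto simp: numerical_range_def csphere_eq_sphere)
    \<comment> \<open>The affine map of the plane that moves \<open>\<alpha>\<close> to \<open>0\<close> and \<open>\<beta>\<close> to \<open>1\<close>, applied to the matrix.\<close>
    define Q where "Q = mat (1 / (\<beta> - \<alpha>)) ** (A - mat \<alpha>)"
    have Q: "numerical_range_map Q v = (numerical_range_map A v - \<alpha>) / (\<beta> - \<alpha>)"
      if "norm v = 1" for v
      using that by (simp add: Q_def numerical_range_map_mat_mult numerical_range_map_diff
          numerical_range_map_mat)
    show ?thesis
    proof
      fix z assume "z \<in> closed_segment \<alpha> \<beta>"
      then obtain s where s: "0 \<le> s" "s \<le> 1" "z = (1 - s) *\<^sub>R \<alpha> + s *\<^sub>R \<beta>"
        by (auto simp: closed_segment_def)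
      have "of_real s \<in> numerical_range Q"
        by (rule unit_interval_subset_numerical_range[of x _ y])
          (use x y s False Q in auto)
      then obtain v where v: "norm v = 1" "numerical_range_map Q v = of_real s"
        by (auto simp: numerical_range_def csphere_eq_sphere)
      have "numerical_range_map A v = z"
        using v(2) False unfolding Q[OF v(1)] s(3) by (simp add: field_simps scaleR_conv_of_real)
      then show "z \<in> numerical_range A"
        using v by (auto simp: numerical_range_def csphere_eq_sphere)
    qed
  qed
  then show ?thesis
    by (simp add: convex_contains_segment)
qed

section \<open>Flat boundary portions as exposed faces\<close>

text \<open>
  The point may lie in the relative interior when \<open>S\<close> has empty interior. Then a hyperplane containing
  \<open>S\<close> supports it.
\<close>

lemma supporting_hyperplane_not_interior:
  fixes S :: "'a::euclidean_space set"
  assumes "convex S" "x \<in> S" "x \<notin> interior S"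
  obtains a where "a \<noteq> 0" "\<And>y. y \<in> S \<Longrightarrow> a \<bullet> y \<le> a \<bullet> x"
proof (cases "interior S = {}")
  case True
  then obtain a b where "a \<noteq> 0" "S \<subseteq> {x. a \<bullet> x = b}"
    using empty_interior_subset_hyperplane[OF assms(1)] by metis
  with assms(2) have "a \<bullet> y \<le> a \<bullet> x" if "y \<in> S" for y
    using that by (metis (mono_tags) mem_Collect_eq order_refl subsetD)
  with \<open>a \<noteq> 0\<close> show ?thesis
    by (rule that)
next
  case False
  then have "x \<notin> rel_interior S"
    using assms(3) rel_interior_nonempty_interior by blast
  then obtain a where "a \<noteq> 0" "\<And>y. y \<in> S \<Longrightarrow> a \<bullet> x \<le> a \<bullet> y"
    using supporting_hyperplane_rel_boundary[OF assms(1,2)] by metis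
  then show ?thesis
    by (intro that[of "- a"]) auto
qed

text \<open>
  A supporting line at the midpoint of a segment in the boundary contains the segment, because the
  linear functional is maximal at an interior point of the segment. The intersection of the line with
  \<open>W(A)\<close> is again a segment in the boundary, so maximality gives equality. In the other direction, a
  segment that meets a line in two points lies on it, so the intersection cannot be enlarged within
  the closed set \<open>W(A)\<close>.
\<close>

lemma flat_boundary_portion_iff_exposed:
  "flat_boundary_portion A s \<longleftrightarrow> proper_segment s \<and>
    (\<exists>a b. a \<noteq> 0 \<and> (\<forall>z\<in>numerical_range A. a \<bullet> z \<le> b) \<and> numerical_range A \<inter> {z. a \<bullet> z = b} = s)"
    (is "?flat \<longleftrightarrow> ?exposed")
proof -
  let ?W = "numerical_range A"
  have frontier: "frontier ?W = ?W - interior ?W"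
    by (simp add: frontier_def compact_numerical_range compact_imp_closed)
  have line_frontier: "?W \<inter> {z. a \<bullet> z = b} \<subseteq> frontier ?W"
    if "a \<noteq> 0" and le: "\<forall>z\<in>?W. a \<bullet> z \<le> b" for a b
  proof -
    have "interior ?W \<subseteq> interior {z. a \<bullet> z \<le> b}"
      using le by (intro interior_mono) auto
    then show ?thesis
      using \<open>a \<noteq> 0\<close> by (auto simp: frontier)
  qed
  show ?thesis
  proof
    assume flat: ?flat
    then obtain p q where pq: "p \<noteq> q" "s = closed_segment p q"
      and s: "s \<subseteq> frontier ?W"
      by (auto simp: flat_boundary_portion_def proper_segment_def)
    define m where "m = midpoint p q"
    have "m \<in> s" unfolding m_def pq by simp
    then have "m \<in> ?W" "m \<notin> interior ?W"
      using s by (auto simp: frontier)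
    then obtain a where a: "a \<noteq> 0" "\<And>z. z \<in> ?W \<Longrightarrow> a \<bullet> z \<le> a \<bullet> m"
      using supporting_hyperplane_not_interior[OF convex_numerical_range] by metis
    define F where "F = ?W \<inter> {z. a \<bullet> z = a \<bullet> m}"
    have F_convex: "convex F"
      unfolding F_def by (intro convex_Int convex_numerical_range convex_hyperplane)
    have "p \<in> ?W" "q \<in> ?W"
      using s pq by (auto simp: frontier)
    moreover have "a \<bullet> m = (a \<bullet> p + a \<bullet> q) / 2"
      by (simp add: m_def midpoint_def inner_add_right)
    ultimately have "p \<in> F" "q \<in> F"
      using a(2)[of p] a(2)[of q] by (auto simp: F_def)
    then have sF: "s \<subseteq> F"
      unfolding pq using F_convex by (simp add: closed_segment_subset)
    have "compact F"
      unfolding F_def by (intro compact_Int_closed compact_numerical_range closed_hyperplane)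
    moreover have "collinear F"
    proof -
      have "aff_dim F \<le> aff_dim {z. a \<bullet> z = a \<bullet> m}"
        by (intro aff_dim_subset) (auto simp: F_def)
      then show ?thesis
        using a(1) by (simp add: collinear_aff_dim)
    qed
    ultimately obtain p' q' where F: "F = closed_segment p' q'"
      using compact_convex_collinear_segment[of F] F_convex \<open>p \<in> F\<close> by blast
    then have "proper_segment F"
      using \<open>p \<in> F\<close> \<open>q \<in> F\<close> \<open>p \<noteq> q\<close> unfolding proper_segment_def
      by (metis closed_segment_idem singletonD)
    moreover have "F \<subseteq> frontier ?W"
      unfolding F_def using a by (intro line_frontier) auto
    ultimately have "F = s"
      using flat sF by (auto simp: flat_boundary_portion_def)
    then show ?exposed
      using \<open>proper_segment F\<close> a unfolding F_def
      by (intro conjI exI[of _ a] exI[of _ "a \<bullet> m"]) auto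
  next
    assume ?exposed
    then obtain a b where "proper_segment s" and a: "a \<noteq> 0" "\<forall>z\<in>?W. a \<bullet> z \<le> b"
      and s: "?W \<inter> {z. a \<bullet> z = b} = s"
      by blast
    have "t = s" if t: "proper_segment t" "t \<subseteq> frontier ?W" "s \<subseteq> t" for t
    proof -
      obtain p q where pq: "t = closed_segment p q"
        using t by (auto simp: proper_segment_def)
      have tW: "t \<subseteq> ?W" using t by (auto simp: frontier)
      obtain x y where xy: "x \<noteq> y" "x \<in> s" "y \<in> s"
        using \<open>proper_segment s\<close> unfolding proper_segment_def by (metis ends_in_segment)
      have on_line: "\<exists>r. z = (1 - r) *\<^sub>R p + r *\<^sub>R q \<and> (1 - r) * (a \<bullet> p) + r * (a \<bullet> q) = b"
        if "z \<in> s" for z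
      proof -
        obtain r where r: "z = (1 - r) *\<^sub>R p + r *\<^sub>R q"
          using t(3) \<open>z \<in> s\<close> by (auto simp: pq closed_segment_def)
        moreover have "a \<bullet> z = b"
          using \<open>z \<in> s\<close> s by blast
        ultimately show ?thesis
          by (auto simp: inner_add_right)
      qed
      obtain r where r: "x = (1 - r) *\<^sub>R p + r *\<^sub>R q" "(1 - r) * (a \<bullet> p) + r * (a \<bullet> q) = b"
        using on_line[OF xy(2)] by blast
      obtain r' where r': "y = (1 - r') *\<^sub>R p + r' *\<^sub>R q" "(1 - r') * (a \<bullet> p) + r' * (a \<bullet> q) = b"
        using on_line[OF xy(3)] by blast
      have "(r - r') * (a \<bullet> q - a \<bullet> p) = 0"
        using r(2) r'(2) by (simp add: algebra_simps)
      moreover have "r \<noteq> r'"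
        using r(1) r'(1) xy(1) by blast
      ultimately have "a \<bullet> q = a \<bullet> p"
        by simp
      with r(2) have "a \<bullet> p = b" "a \<bullet> q = b"
        by (simp_all add: algebra_simps)
      then have "t \<subseteq> {z. a \<bullet> z = b}"
        unfolding pq by (intro closed_segment_subset convex_hyperplane) auto
      then show ?thesis
        using t s tW by blast
    qed
    moreover have "s \<subseteq> frontier ?W"
      using line_frontier[OF a] s by simp
    ultimately show ?flat
      using \<open>proper_segment s\<close> unfolding flat_boundary_portion_def by blast
  qed
qed


section \<open>Linear combinations of vectors generating a face\<close>

text \<open>
  With \<open>v = a x + b y\<close> and \<open>v' = a x - b y\<close>, the parallelogram law for the form and for the norm says
  that one and the same point is a convex combination of the values at \<open>x\<close> and \<open>y\<close>, hence in \<open>F\<close>, and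
  of the value at \<open>v\<close> and the normalised value at \<open>v'\<close>, the first with positive weight. The
  defining property of a face puts the value at \<open>v\<close> into \<open>F\<close>.
\<close>

lemma numerical_range_map_combination_in_face:
  assumes F: "F face_of numerical_range A"
    and x: "norm x = 1" "numerical_range_map A x \<in> F"
    and y: "norm y = 1" "numerical_range_map A y \<in> F"
    and norm: "norm (a *s x + b *s y) = 1"
  shows "numerical_range_map A (a *s x + b *s y) \<in> F"
proof (cases "a *s x = b *s y")
  case True
  then have "a *s x + b *s y = (2 * a) *s x"
    by (metis mult_2 vector_sadd_rdistrib)
  then show ?thesis
    using norm x by (simp add: numerical_range_map_scale norm_vector_scalar_mult)
next
  case False
  let ?v = "a *s x + b *s y" and ?v' = "a *s x - b *s y"
  define N where "N = (norm ?v')\<^sup>2"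
  have "N > 0"
    using False by (simp add: N_def)
  obtain z where z: "z \<in> numerical_range A" "numerical_range_map A ?v' = of_real N * z"
    using numerical_range_map_eq_norm_mult[of ?v' A] False unfolding N_def by auto
  have W: "numerical_range_map A ?v \<in> numerical_range A"
    using norm by (simp add: numerical_range_def csphere_eq_sphere)
  have sum: "1 + N = 2 * (norm a)\<^sup>2 + 2 * (norm b)\<^sup>2"
  proof -
    have "complex_of_real (1 + N) = of_real (2 * (norm a)\<^sup>2 + 2 * (norm b)\<^sup>2)"
      using numerical_range_map_parallelogram[of "mat 1" "a *s x" "b *s y"] norm x y
      by (simp add: numerical_range_map_mat norm_vector_scalar_mult N_def)
    then show ?thesis
      by (simp only: of_real_eq_iff)
  qed
  \<comment> \<open>The weights of \<open>v'\<close> and of \<open>y\<close> in the two convex combinations.\<close>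
  define c where "c = N / (1 + N)"
  define d where "d = 2 * (norm b)\<^sup>2 / (1 + N)"
  have c: "0 < c" "c < 1" "1 - c = 1 / (1 + N)"
    using \<open>N > 0\<close> by (auto simp: c_def field_simps)
  have "1 - d = 2 * (norm a)\<^sup>2 / (1 + N)" "0 \<le> d"
    using \<open>N > 0\<close> sum by (auto simp: d_def field_simps)
  moreover have "0 \<le> 2 * (norm a)\<^sup>2 / (1 + N)"
    using \<open>N > 0\<close> by simp
  ultimately have d: "0 \<le> d" "d \<le> 1" "1 - d = 2 * (norm a)\<^sup>2 / (1 + N)"
    by linarith+
  have "numerical_range_map A ?v + of_real N * z
    = of_real (2 * (norm a)\<^sup>2) * numerical_range_map A x + of_real (2 * (norm b)\<^sup>2) * numerical_range_map A y"
    using numerical_range_map_parallelogram[of A "a *s x" "b *s y"] z(2)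
    by (simp add: numerical_range_map_scale mult.assoc)
  then have "(1 / (1 + N)) *\<^sub>R (numerical_range_map A ?v + of_real N * z)
    = (1 / (1 + N)) *\<^sub>R (of_real (2 * (norm a)\<^sup>2) * numerical_range_map A x
        + of_real (2 * (norm b)\<^sup>2) * numerical_range_map A y)"
    by simp
  then have eq: "(1 - c) *\<^sub>R numerical_range_map A ?v + c *\<^sub>R z
    = (1 - d) *\<^sub>R numerical_range_map A x + d *\<^sub>R numerical_range_map A y"
    unfolding c(3) d(3) by (simp add: c_def d_def scaleR_conv_of_real distrib_left)
  then have mem: "(1 - c) *\<^sub>R numerical_range_map A ?v + c *\<^sub>R z \<in> F"
    using convexD_alt[OF face_of_imp_convex[OF F] x(2) y(2) d(1,2)] by simp
  show ?thesis
  proof (cases "numerical_range_map A ?v = z")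
    case True
    then show ?thesis
      using mem by (simp flip: scaleR_left_distrib)
  next
    case False
    then have "(1 - c) *\<^sub>R numerical_range_map A ?v + c *\<^sub>R z \<in> open_segment (numerical_range_map A ?v) z"
      using c by (auto simp: in_segment)
    then show ?thesis
      using F mem W z(1) by (meson face_ofD)
  qed
qed

text \<open>One step of the Gram--Schmidt process.\<close>

lemma orthonormal_completion:
  assumes x: "norm x = 1" and y: "\<And>c. y \<noteq> c *s x"
  obtains a b where "norm (a *s x + b *s y) = 1" "hermitian_prod x (a *s x + b *s y) = 0"
proof -
  define w where "w = y - hermitian_prod x y *s x"
  have "w \<noteq> 0"
    using y by (simp add: w_def)
  have xw: "hermitian_prod x w = 0"
    using x by (simp add: w_def hermitian_prod_simps hermitian_prod_self)
  define c where "c = complex_of_real (1 / norm w)"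
  have g: "c *s w = (- c * hermitian_prod x y) *s x + c *s y"
    by (simp add: w_def vec_eq_iff algebra_simps)
  show ?thesis
  proof (rule that)
    show "norm ((- c * hermitian_prod x y) *s x + c *s y) = 1"
      unfolding g[symmetric] using \<open>w \<noteq> 0\<close>
      by (simp add: norm_vector_scalar_mult c_def norm_divide)
    show "hermitian_prod x ((- c * hermitian_prod x y) *s x + c *s y) = 0"
      unfolding g[symmetric] by (simp add: hermitian_prod_scale_right xw)
  qed
qed

lemma orthonormal_imp_multiply_generated:
  assumes "norm x = 1" "norm y = 1" "hermitian_prod x y = 0"
    and "numerical_range_map A x = \<alpha>" "numerical_range_map A y = \<alpha>"
  shows "multiply_generated A \<alpha>"
proof -
  have not_multiple: "x \<noteq> c *s y" for c
  proof
    assume "x = c *s y"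
    then have "hermitian_prod x x = c * hermitian_prod x y"
      by (metis hermitian_prod_scale_right)
    then show False
      using assms by (simp add: hermitian_prod_self)
  qed
  then have "x \<noteq> y"
    using vector_smult_lid by metis
  moreover have "x \<notin> vec.span {y}"
    using not_multiple by (auto simp: vec.span_singleton)
  moreover have "y \<noteq> 0"
    using assms(2) by auto
  ultimately have "vec.independent {x, y}"
    by (simp add: vec.independent_insert)
  then show ?thesis
    using assms \<open>x \<noteq> y\<close> unfolding multiply_generated_def
    by (intro exI[of _ x] exI[of _ y]) (simp add: csphere_eq_sphere)
qed

text \<open>
  This uses extremality: \<open>{\<alpha>}\<close> is a face, so the Gram--Schmidt process does not leave the fibre.
  A point of \<open>W(A)\<close> that is not extreme may have independent generators without having orthogonal
  ones.
\<close>

lemma multiply_generated_extreme_point_imp_orthonormal: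
  assumes ext: "\<alpha> extreme_point_of numerical_range A" and mult: "multiply_generated A \<alpha>"
  obtains x y where "norm x = 1" "norm y = 1" "hermitian_prod x y = 0"
    "numerical_range_map A x = \<alpha>" "numerical_range_map A y = \<alpha>"
proof -
  obtain x y where x: "norm x = 1" "numerical_range_map A x = \<alpha>"
    and y: "norm y = 1" "numerical_range_map A y = \<alpha>"
    and xy: "x \<noteq> y" "vec.independent {x, y}"
    using mult by (auto simp: multiply_generated_def csphere_eq_sphere)
  have "y \<notin> vec.span {x}"
    using xy vec.independent_insert[of y "{x}"] by (simp add: insert_commute)
  then have "y \<noteq> c *s x" for c
    by (auto simp: vec.span_singleton)
  then obtain a b where g: "norm (a *s x + b *s y) = 1" "hermitian_prod x (a *s x + b *s y) = 0"
    using orthonormal_completion[OF x(1)] by metis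
  have "numerical_range_map A (a *s x + b *s y) \<in> {\<alpha>}"
    using ext x y g by (intro numerical_range_map_combination_in_face) (simp_all add: face_of_singleton)
  then show ?thesis
    using that x g by blast
qed

lemma flat_boundary_portion_imp_orthonormal:
  assumes "flat_boundary_portion A s"
  obtains x y where "norm x = 1" "norm y = 1" "hermitian_prod x y = 0"
    "numerical_range_map A x \<in> s" "numerical_range_map A y \<in> s"
proof -
  obtain a b p q where s: "s = closed_segment p q" "p \<noteq> q"
    and ab: "\<forall>z\<in>numerical_range A. a \<bullet> z \<le> b" "numerical_range A \<inter> {z. a \<bullet> z = b} = s"
    using assms unfolding flat_boundary_portion_iff_exposed proper_segment_def by blast
  have face: "s face_of numerical_range A"
    using face_of_Int_supporting_hyperplane_le[OF convex_numerical_range] ab by metis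
  have "p \<in> numerical_range A" "q \<in> numerical_range A"
    using ab(2) s(1) by auto
  then obtain x y where x: "norm x = 1" "numerical_range_map A x = p"
    and y: "norm y = 1" "numerical_range_map A y = q"
    by (auto simp: numerical_range_def csphere_eq_sphere)
  have "y \<noteq> c *s x" for c
    using x y s(2) by (auto simp: numerical_range_map_scale norm_vector_scalar_mult)
  then obtain a b where g: "norm (a *s x + b *s y) = 1" "hermitian_prod x (a *s x + b *s y) = 0"
    using orthonormal_completion[OF x(1)] by metis
  have "numerical_range_map A (a *s x + b *s y) \<in> s"
    using face x y g s by (intro numerical_range_map_combination_in_face) simp_all
  then show ?thesis
    using that[of x "a *s x + b *s y"] x g s by simp
qed

section \<open>Births come from orthonormal pairs\<close>

lemma dist_le_hausdorff_dist_singleton: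
  assumes "bounded S" "z \<in> S"
  shows "dist z a \<le> hausdorff_dist S {a}"
proof -
  have "bdd_above ((\<lambda>x. dist x a) ` S)"
    using assms(1) by (metis bdd_above.I2 bounded_any_center dist_commute)
  then have "dist z a \<le> (SUP x\<in>S. infdist x {a})"
    using assms(2) by (auto intro: cSUP_upper)
  then show ?thesis
    by (simp add: hausdorff_dist_def)
qed

lemma hausdorff_dist_singleton_bounds:
  assumes "S \<noteq> {}" "\<And>z. z \<in> S \<Longrightarrow> dist z a \<le> r"
  shows "0 \<le> hausdorff_dist S {a}" "hausdorff_dist S {a} \<le> r"
proof -
  have "(SUP x\<in>S. infdist x {a}) \<le> r"
    using assms by (intro cSUP_least) auto
  moreover have "infdist a S \<le> r"
    using assms by (metis all_not_in_conv dist_commute infdist_le order_trans)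
  ultimately show "hausdorff_dist S {a} \<le> r"
    by (simp add: hausdorff_dist_def)
  show "0 \<le> hausdorff_dist S {a}"
    by (simp add: hausdorff_dist_def infdist_nonneg le_max_iff_disj)
qed

lemma born_at_imp_multiply_generated:
  fixes A :: "complex ^ 'n ^ 'n"
  assumes "flat_boundary_portion_born_at A \<alpha>"
  shows "multiply_generated A \<alpha>"
proof -
  obtain B s where B: "B \<longlonglongrightarrow> A" and flat: "\<And>i. flat_boundary_portion (B i) (s i)"
    and haus: "(\<lambda>i. hausdorff_dist (s i) {\<alpha>}) \<longlonglongrightarrow> 0"
    using assms unfolding flat_boundary_portion_born_at_def by blast
  have "\<exists>p. p \<in> sphere 0 1 \<times> sphere 0 1 \<and> hermitian_prod (fst p) (snd p) = 0 \<and>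
      numerical_range_map (B i) (fst p) \<in> s i \<and> numerical_range_map (B i) (snd p) \<in> s i" for i
    using flat_boundary_portion_imp_orthonormal[OF flat[of i]]
    by (metis dist_0_norm fst_conv snd_conv mem_Sigma_iff mem_sphere)
  then obtain p where p: "\<And>i. p i \<in> sphere 0 1 \<times> sphere 0 1"
    "\<And>i. hermitian_prod (fst (p i)) (snd (p i)) = 0"
    and p_in: "\<And>i. numerical_range_map (B i) (fst (p i)) \<in> s i"
      "\<And>i. numerical_range_map (B i) (snd (p i)) \<in> s i"
    by metis
  have "seq_compact (sphere (0 :: complex ^ 'n) 1 \<times> sphere (0 :: complex ^ 'n) 1)"
    by (intro compact_imp_seq_compact compact_Times compact_sphere)
  then obtain l r where l: "l \<in> sphere 0 1 \<times> sphere 0 1" and r: "strict_mono r"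
    and lim: "(p \<circ> r) \<longlonglongrightarrow> l"
    using p(1) unfolding seq_compact_def by metis
  have lim_fst: "(\<lambda>i. fst (p (r i))) \<longlonglongrightarrow> fst l"
    and lim_snd: "(\<lambda>i. snd (p (r i))) \<longlonglongrightarrow> snd l"
    using tendsto_fst[OF lim] tendsto_snd[OF lim] by (simp_all add: o_def)
  have bounded: "bounded (s i)" for i
    using flat[of i] bounded_subset[OF compact_imp_bounded[OF compact_numerical_range]]
    by (auto simp: flat_boundary_portion_iff_exposed)
  have to_\<alpha>: "z \<longlonglongrightarrow> \<alpha>" if "\<And>i. z i \<in> s i" for z
    by (rule metric_tendsto_imp_tendsto[OF haus])
      (simp add: dist_real_def order_trans[OF dist_le_hausdorff_dist_singleton[OF bounded that] abs_ge_self])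
  have Br: "(\<lambda>i. B (r i)) \<longlonglongrightarrow> A"
    using LIMSEQ_subseq_LIMSEQ[OF B r] by (simp add: o_def)
  have limit_value: "numerical_range_map A v = \<alpha>"
    if "(\<lambda>i. w (r i)) \<longlonglongrightarrow> v" "\<And>i. numerical_range_map (B i) (w i) \<in> s i" for v w
  proof (rule LIMSEQ_unique)
    show "(\<lambda>i. numerical_range_map (B (r i)) (w (r i))) \<longlonglongrightarrow> numerical_range_map A v"
      by (rule tendsto_numerical_range_map[OF Br that(1)])
    show "(\<lambda>i. numerical_range_map (B (r i)) (w (r i))) \<longlonglongrightarrow> \<alpha>"
      using LIMSEQ_subseq_LIMSEQ[OF to_\<alpha>[OF that(2)] r] by (simp add: o_def)
  qed
  have "hermitian_prod (fst l) (snd l) = 0"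
    using tendsto_hermitian_prod[OF lim_fst lim_snd] p(2) by (simp add: LIMSEQ_const_iff)
  then show ?thesis
    using l limit_value[OF lim_fst p_in(1)] limit_value[OF lim_snd p_in(2)]
    by (intro orthonormal_imp_multiply_generated[of "fst l" "snd l"]) auto
qed

section \<open>Orthonormal pairs give births\<close>

text \<open>Bessel's inequality with its remainder, which detects when \<open>v\<close> is in the span.\<close>

lemma bessel_two:
  assumes "norm x = 1" "norm y = 1" "hermitian_prod x y = 0"
  shows "(norm v)\<^sup>2 = (norm (hermitian_prod x v))\<^sup>2 + (norm (hermitian_prod y v))\<^sup>2
    + (norm (v - (hermitian_prod x v *s x + hermitian_prod y v *s y)))\<^sup>2"
proof -
  define w where "w = v - (hermitian_prod x v *s x + hermitian_prod y v *s y)"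
  have yx: "hermitian_prod y x = 0"
    using assms(3) by (metis cnj_hermitian_prod complex_cnj_zero)
  have v: "v = w + (hermitian_prod x v *s x + hermitian_prod y v *s y)"
    by (simp add: w_def)
  have xx: "hermitian_prod x x = 1" "hermitian_prod y y = 1"
    using assms by (simp_all add: hermitian_prod_self)
  have w: "hermitian_prod x w = 0" "hermitian_prod y w = 0"
    by (simp_all add: w_def hermitian_prod_simps xx yx assms(3))
  then have w': "hermitian_prod w x = 0" "hermitian_prod w y = 0"
    by (metis cnj_hermitian_prod complex_cnj_zero)+
  have "hermitian_prod v v = hermitian_prod x v * cnj (hermitian_prod x v)
      + hermitian_prod y v * cnj (hermitian_prod y v) + hermitian_prod w w"
    by (subst (1 2) v) (simp add: hermitian_prod_simps w w' xx yx assms(3))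
  then have "complex_of_real ((norm v)\<^sup>2) = of_real ((norm (hermitian_prod x v))\<^sup>2
      + (norm (hermitian_prod y v))\<^sup>2 + (norm w)\<^sup>2)"
    unfolding hermitian_prod_self complex_norm_square[symmetric] of_real_add .
  then show ?thesis
    unfolding w_def by (simp only: of_real_eq_iff)
qed

definition outer_square :: "complex ^ 'n \<Rightarrow> complex ^ 'n ^ 'n"
  where "outer_square x = (\<chi> i j. x $ i * cnj (x $ j))"

lemma numerical_range_map_outer_square:
  "numerical_range_map (outer_square x) v = of_real ((norm (hermitian_prod x v))\<^sup>2)"
proof -
  have "outer_square x *v v = hermitian_prod x v *s x"
    by (simp add: outer_square_def matrix_vector_mult_def hermitian_prod_def vec_eq_iff
        sum_distrib_left sum_distrib_right mult_ac)
  then show ?thesis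
    unfolding numerical_range_map_def
    by (simp add: hermitian_prod_scale_right complex_norm_square cnj_hermitian_prod
        del: of_real_power)
qed

lemma numerical_range_map_scaleR:
  "numerical_range_map (r *\<^sub>R A) v = of_real r * numerical_range_map A v"
  by (simp add: numerical_range_map_def hermitian_prod_def matrix_vector_mult_def
      scaleR_conv_of_real[where 'a = complex] sum_distrib_left mult_ac)

text \<open>
  For a unit vector \<open>v\<close> let \<open>P\<close> and \<open>R\<close> be the squared moduli of its components along \<open>x\<close> and \<open>y\<close>. The
  perturbation adds \<open>r u (P + R - 1 + \<i> P)\<close> to the value at \<open>v\<close>. By Bessel's inequality the part along
  \<open>u\<close> is at most zero, so the supporting line stays one, and it vanishes only on the span of \<open>x\<close> and
  \<open>y\<close>, where the original value is \<open>\<alpha>\<close>. The new values on the line are thus \<open>\<alpha> + \<i> r u P\<close> with \<open>P\<close> between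
  \<open>0\<close> and \<open>1\<close>, and \<open>y\<close> and \<open>x\<close> attain the two ends.
\<close>

lemma perturbation_has_short_flat_boundary_portion:
  fixes u :: complex
  assumes ext: "\<alpha> extreme_point_of numerical_range A"
    and u: "u \<noteq> 0" "\<And>z. z \<in> numerical_range A \<Longrightarrow> u \<bullet> z \<le> u \<bullet> \<alpha>"
    and x: "norm x = 1" "numerical_range_map A x = \<alpha>"
    and y: "norm y = 1" "numerical_range_map A y = \<alpha>"
    and xy: "hermitian_prod x y = 0"
    and r: "0 < r"
  shows "flat_boundary_portion
      (A + r *\<^sub>R (mat u ** (mat (1 + \<i>) ** outer_square x + outer_square y - mat 1)))
      (closed_segment \<alpha> (\<alpha> + of_real r * (\<i> * u)))"
proof -
  define B where
    "B = A + r *\<^sub>R (mat u ** (mat (1 + \<i>) ** outer_square x + outer_square y - mat 1))"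
  define P R where "P v = (norm (hermitian_prod x v))\<^sup>2" and "R v = (norm (hermitian_prod y v))\<^sup>2" for v
  define \<beta> where "\<beta> = \<alpha> + of_real r * (\<i> * u)"
  have B: "numerical_range_map B v = numerical_range_map A v
      + of_real r * (u * (of_real (P v + R v - 1) + \<i> * of_real (P v)))" if "norm v = 1" for v
    using that by (simp add: B_def P_def R_def numerical_range_map_add numerical_range_map_diff
        numerical_range_map_scaleR numerical_range_map_mat_mult numerical_range_map_mat
        numerical_range_map_outer_square algebra_simps)
  have inner_u: "u \<bullet> (of_real r * (u * w)) = r * (norm u)\<^sup>2 * Re w" for w
    unfolding cmod_power2 by (simp add: inner_complex_def algebra_simps power2_eq_square)
  have height: "u \<bullet> numerical_range_map B v
      = u \<bullet> numerical_range_map A v + r * (norm u)\<^sup>2 * (P v + R v - 1)" if "norm v = 1" for v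
    unfolding B[OF that] inner_add_right inner_u by simp
  have bessel: "P v + R v \<le> 1" if "norm v = 1" for v
    unfolding P_def R_def
    using bessel_two[OF x(1) y(1) xy, of v] zero_le_power2
    unfolding that one_power2 by (metis le_add_same_cancel1)
  have ru: "0 < r * (norm u)\<^sup>2"
    using r u by simp
  have A_le: "u \<bullet> numerical_range_map A v \<le> u \<bullet> \<alpha>" if "norm v = 1" for v
    using that by (intro u) (simp add: numerical_range_def csphere_eq_sphere)
  have drop: "r * (norm u)\<^sup>2 * (P v + R v - 1) \<le> 0" if "norm v = 1" for v
    using bessel[OF that] ru by (intro mult_nonneg_nonpos) auto
  have le: "\<forall>z\<in>numerical_range B. u \<bullet> z \<le> u \<bullet> \<alpha>"
  proof
    fix z assume "z \<in> numerical_range B"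
    then obtain v where "norm v = 1" "z = numerical_range_map B v"
      by (auto simp: numerical_range_def csphere_eq_sphere)
    then show "u \<bullet> z \<le> u \<bullet> \<alpha>"
      using height A_le drop by fastforce
  qed
  let ?F = "numerical_range B \<inter> {z. u \<bullet> z = u \<bullet> \<alpha>}"
  have "?F \<subseteq> closed_segment \<alpha> \<beta>"
  proof
    fix z assume z: "z \<in> ?F"
    then obtain v where v: "norm v = 1" "z = numerical_range_map B v"
      by (auto simp: numerical_range_def csphere_eq_sphere)
    then have "r * (norm u)\<^sup>2 * (P v + R v - 1) = 0"
      using z height[OF v(1)] A_le[OF v(1)] drop[OF v(1)] unfolding v(2)[symmetric]
      by (simp only: Int_iff mem_Collect_eq) linarith
    then have PR: "P v + R v = 1"
      using ru by auto
    then have "v = hermitian_prod x v *s x + hermitian_prod y v *s y"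
      using bessel_two[OF x(1) y(1) xy, of v] v(1) by (simp add: P_def R_def)
    moreover have "numerical_range_map A (hermitian_prod x v *s x + hermitian_prod y v *s y) \<in> {\<alpha>}"
      using ext x y calculation v(1)
      by (intro numerical_range_map_combination_in_face) (simp_all add: face_of_singleton)
    ultimately have "numerical_range_map A v = \<alpha>"
      by simp
    then have "z = (1 - P v) *\<^sub>R \<alpha> + P v *\<^sub>R \<beta>"
      unfolding v(2) B[OF v(1)] PR \<beta>_def by (simp add: scaleR_conv_of_real algebra_simps)
    moreover have "0 \<le> P v" "P v \<le> 1"
      using PR zero_le_power2[of "norm (hermitian_prod x v)"] zero_le_power2[of "norm (hermitian_prod y v)"]
      unfolding P_def R_def by linarith+
    ultimately show "z \<in> closed_segment \<alpha> \<beta>"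
      by (auto simp: closed_segment_def)
  qed
  moreover have "closed_segment \<alpha> \<beta> \<subseteq> ?F"
  proof (rule closed_segment_subset)
    have "P x = 1" "R x = 0" "P y = 0" "R y = 1"
      using x y xy cnj_hermitian_prod[of x y] by (simp_all add: P_def R_def hermitian_prod_self)
    then have "numerical_range_map B x = \<beta>" "numerical_range_map B y = \<alpha>"
      using x y by (simp_all add: B \<beta>_def mult_ac)
    then have "\<alpha> \<in> numerical_range B" "\<beta> \<in> numerical_range B"
      using x(1) y(1) by (force simp: numerical_range_def csphere_eq_sphere)+
    moreover have "u \<bullet> \<beta> = u \<bullet> \<alpha>"
      using inner_u[of \<i>] by (simp add: \<beta>_def inner_add_right mult.commute)
    ultimately show "\<alpha> \<in> ?F" "\<beta> \<in> ?F"
      by auto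
    show "convex ?F"
      by (intro convex_Int convex_numerical_range convex_hyperplane)
  qed
  ultimately have "?F = closed_segment \<alpha> \<beta>" ..
  moreover have "\<alpha> \<noteq> \<beta>"
    using r u by (simp add: \<beta>_def)
  ultimately show ?thesis
    unfolding B_def[symmetric] \<beta>_def[symmetric] flat_boundary_portion_iff_exposed proper_segment_def
    using le u(1) by blast
qed

lemma multiply_generated_imp_born_at:
  assumes ext: "\<alpha> extreme_point_of numerical_range A" and mult: "multiply_generated A \<alpha>"
  shows "flat_boundary_portion_born_at A \<alpha>"
proof -
  obtain x y where xy: "norm x = 1" "norm y = 1" "hermitian_prod x y = 0"
    "numerical_range_map A x = \<alpha>" "numerical_range_map A y = \<alpha>"
    using multiply_generated_extreme_point_imp_orthonormal[OF ext mult] .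
  have "\<alpha> \<in> numerical_range A" "\<alpha> \<notin> interior (numerical_range A)"
    using ext extreme_point_not_in_interior by (auto simp: extreme_point_of_def)
  then obtain u where u: "u \<noteq> 0" "\<And>z. z \<in> numerical_range A \<Longrightarrow> u \<bullet> z \<le> u \<bullet> \<alpha>"
    using supporting_hyperplane_not_interior[OF convex_numerical_range] by metis
  define C where "C = mat u ** (mat (1 + \<i>) ** outer_square x + outer_square y - mat 1)"
  define r where "r n = inverse (real (Suc n))" for n
  define s where "s n = closed_segment \<alpha> (\<alpha> + of_real (r n) * (\<i> * u))" for n
  have r: "r \<longlonglongrightarrow> 0" and r_pos: "0 < r n" for n
    unfolding r_def by (rule LIMSEQ_inverse_real_of_nat) simp
  have "(\<lambda>n. A + r n *\<^sub>R C) \<longlonglongrightarrow> A + 0 *\<^sub>R C"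
    by (intro tendsto_intros r)
  moreover have "flat_boundary_portion (A + r n *\<^sub>R C) (s n)" for n
    unfolding C_def s_def
    by (rule perturbation_has_short_flat_boundary_portion[OF ext u xy(1,4,2,5,3) r_pos])
  moreover have "(\<lambda>n. hausdorff_dist (s n) {\<alpha>}) \<longlonglongrightarrow> 0"
  proof (rule tendsto_sandwich)
    have "dist z \<alpha> \<le> r n * norm u" if "z \<in> s n" for n z
      using dist_in_closed_segment[of z \<alpha> "\<alpha> + of_real (r n) * (\<i> * u)"] that r_pos[of n]
      by (simp add: s_def dist_norm norm_mult norm_minus_commute)
    moreover have "s n \<noteq> {}" for n
      by (simp add: s_def)
    ultimately show "\<forall>\<^sub>F n in sequentially. 0 \<le> hausdorff_dist (s n) {\<alpha>}"
      "\<forall>\<^sub>F n in sequentially. hausdorff_dist (s n) {\<alpha>} \<le> r n * norm u"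
      by (intro always_eventually allI hausdorff_dist_singleton_bounds; blast)+
    show "(\<lambda>n. r n * norm u) \<longlonglongrightarrow> 0"
      using tendsto_mult_left_zero[OF r] .
  qed simp
  ultimately show ?thesis
    unfolding flat_boundary_portion_born_at_def
    by (intro exI[of _ "\<lambda>n. A + r n *\<^sub>R C"] exI[of _ s]) simp
qed

theorem theorem1p1:
  fixes A :: "complex ^ 'n ^ 'n" and \<alpha> :: complex
  assumes "\<alpha> extreme_point_of numerical_range A"
  shows "flat_boundary_portion_born_at A \<alpha> \<longleftrightarrow> multiply_generated A \<alpha>"
  using assms born_at_imp_multiply_generated multiply_generated_imp_born_at by blast

end
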